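(* Let $N\ge1$ be an even integer, $h=\sqrt2\,N^{-1/2}$, and for $n,k\in\{0,\dots,N\}$ set $$\phi_n(k)=\sqrt h\;\varphi_{n,h}(a_k),\qquad a_k=-\tfrac1h+hk .$$ Let $L=(\phi_n(k))_{0\le n,k\le N}$ be the $(N+1)\times(N+1)$ matrix with entry $\phi_n(k)$ in row $n$ and column $k$. Then for every function $f:\mathbb{R}\to\mathbb{C}$, with $F(k)=\sqrt h\,f(a_k)$, $F=(F(k))_{k=0}^N$ and $C=(c_{n,h}(f))_{n=0}^N$, $$c_{n,h}(f)=\sum_{k=0}^N\phi_n(k)F(k)\quad(0\le n\le N),\qquad\text{i.e. } C=LF,$$ and $$L=e^{\frac{i\pi(N+1)}{4}}\,D\,e^{-\frac{i\pi}{4}A}\,D^*,$$ where $D=\mathrm{diag}\big(1,e^{i\frac\pi2},\dots,e^{i\frac{\pi N}2}\big)$ (entry $e^{i\pi k/2}$ for $k=0,\dots,N$), $D^*$ is its conjugate transpose, and $A$ is the real symmetric tridiagonal $(N+1)\times(N+1)$ matrix whose diagonal entries all equal $N+1$ and whose sub- and super-diagonal entries are successively $-\beta_1,\dots,-\beta_N$, with $\beta_k=\sqrt{k(N-k+1)}$ for $1\le k\le N$.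
   Context: Set $A_h=h\mathbb{Z}\cap[-1/h,1/h]=\{a_0,\dots,a_N\}$. Scaled Kravchuk polynomials: $k_{0,h}=1$, $k_{n,h}=0$ for $n<0$, $k_{n+1,h}(x)=2x\,k_{n,h}(x)-2n\left(1-h^2\frac{n-1}{2}\right)k_{n-1,h}(x)$. Kravchuk functions: for $0\le n\le N$, $a\in h\mathbb{Z}$, $\varphi_{n,h}(a)=\alpha_{n,h}k_{n,h}(a)\sqrt{\rho_h(a)}$, where $\alpha_{n,h}=\frac1{h^n}\sqrt{\frac{(N-n)!}{N!\,n!}}$, $\rho_h(a)=\frac1{h2^N}\binom Nk$ with $k=\frac1{h^2}+\frac ah$ for $a\in A_h$, and $\rho_h(a)=0$ for $a\notin A_h$. The discrete Kravchuk coefficients of $f$ are $c_{n,h}(f)=h\sum_{a\in A_h}\varphi_{n,h}(a)f(a)$. *)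

theory Defs
  imports Complex_Main "Jordan_Normal_Form.Schur_Decomposition"
begin

(* The Kravchuk objects below are meant for N even and h = sqrt (2 / N), so that
   1 / h^2 = N / 2 and N h^2 = 2. The parameter N is determined by h in this case; it is
   carried along explicitly to keep the definitions elementary. *)

definition kravchuk_lattice :: "real \<Rightarrow> real set" where
  "kravchuk_lattice h = {a. (\<exists>m::int. a = h * of_int m) \<and> a \<in> {- 1 / h..1 / h}}"

definition kravchuk_node :: "real \<Rightarrow> nat \<Rightarrow> real" where
  "kravchuk_node h k = - 1 / h + h * real k"

(* The three-term recurrence k_{n+1} = 2 x k_n - 2 n (1 - h^2 (n - 1) / 2) k_{n-1} with k_0 = 1
   and k_{-1} = 0. The second equation is the instance n = 0; the third one is the instance
   n + 1, so that n in the recurrence becomes n + 1 and n - 1 becomes n. *)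
fun kravchuk_poly :: "real \<Rightarrow> nat \<Rightarrow> real \<Rightarrow> real" where
  "kravchuk_poly h 0 x = 1"
| "kravchuk_poly h (Suc 0) x = 2 * x"
| "kravchuk_poly h (Suc (Suc n)) x =
     2 * x * kravchuk_poly h (Suc n) x
     - 2 * real (Suc n) * (1 - h\<^sup>2 * (real n / 2)) * kravchuk_poly h n x"

definition kravchuk_alpha :: "nat \<Rightarrow> real \<Rightarrow> nat \<Rightarrow> real" where
  "kravchuk_alpha N h n = 1 / h ^ n * sqrt (fact (N - n) / (fact N * fact n))"

(* For a in the lattice, 1 / h^2 + a / h is an integer in {0..N}: the floor is only a
   conversion of types. *)
definition kravchuk_rho :: "nat \<Rightarrow> real \<Rightarrow> real \<Rightarrow> real" where
  "kravchuk_rho N h a =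
     (if a \<in> kravchuk_lattice h
      then 1 / (h * 2 ^ N) * real (N choose nat \<lfloor>1 / h\<^sup>2 + a / h\<rfloor>)
      else 0)"

definition kravchuk_fun :: "nat \<Rightarrow> real \<Rightarrow> nat \<Rightarrow> real \<Rightarrow> real" where
  "kravchuk_fun N h n a =
     kravchuk_alpha N h n * kravchuk_poly h n a * sqrt (kravchuk_rho N h a)"

definition kravchuk_coeff :: "nat \<Rightarrow> real \<Rightarrow> nat \<Rightarrow> (real \<Rightarrow> complex) \<Rightarrow> complex" where
  "kravchuk_coeff N h n f =
     of_real h * (\<Sum>a\<in>kravchuk_lattice h. of_real (kravchuk_fun N h n a) * f a)"

definition kravchuk_phi :: "nat \<Rightarrow> real \<Rightarrow> nat \<Rightarrow> nat \<Rightarrow> real" where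
  "kravchuk_phi N h n k = sqrt h * kravchuk_fun N h n (kravchuk_node h k)"

definition kravchuk_L :: "nat \<Rightarrow> real \<Rightarrow> complex mat" where
  "kravchuk_L N h =
     Matrix.mat (N + 1) (N + 1) (\<lambda>(n, k). complex_of_real (kravchuk_phi N h n k))"

definition kravchuk_beta :: "nat \<Rightarrow> nat \<Rightarrow> real" where
  "kravchuk_beta N k = sqrt (real (k * (N - k + 1)))"

(* Rows and columns are numbered from 0, so beta_k sits at (k - 1, k) and at (k, k - 1). *)
definition kravchuk_A :: "nat \<Rightarrow> real mat" where
  "kravchuk_A N = Matrix.mat (N + 1) (N + 1) (\<lambda>(i, j).
     if i = j then real (N + 1)
     else if j = i + 1 then - kravchuk_beta N j
     else if i = j + 1 then - kravchuk_beta N i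
     else 0)"

definition kravchuk_D :: "nat \<Rightarrow> complex mat" where
  "kravchuk_D N = mat_diag (N + 1) (\<lambda>k. exp (\<i> * of_real pi * of_nat k / 2))"

(* The exponential series of a square matrix, summed entry by entry. *)
definition mat_exp :: "complex mat \<Rightarrow> complex mat" where
  "mat_exp A = Matrix.mat (dim_row A) (dim_row A)
     (\<lambda>(i, j). \<Sum>m. (A ^\<^sub>m m) $$ (i, j) / fact m)"

lemma norm_pow_mat_le:
  fixes A :: "complex mat"
  assumes A: "A \<in> carrier_mat n n" and i: "i < n" and j: "j < n"
    and c: "\<And>k l. k < n \<Longrightarrow> l < n \<Longrightarrow> cmod (A $$ (k, l)) \<le> c"
  shows "cmod ((A ^\<^sub>m m) $$ (i, j)) \<le> (real n * c) ^ m"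
  using i j
proof (induction m arbitrary: j)
  case 0
  then show ?case using A by auto
next
  case (Suc m)
  have P: "A ^\<^sub>m m \<in> carrier_mat n n" using A by simp
  have "0 \<le> cmod (A $$ (i, i))" by simp
  also have "\<dots> \<le> c" by (rule c[OF i i])
  finally have c0: "0 \<le> c" .
  have "(A ^\<^sub>m Suc m) $$ (i, j) = (\<Sum>k = 0..<n. (A ^\<^sub>m m) $$ (i, k) * A $$ (k, j))"
    using A P Suc.prems by (simp add: scalar_prod_def)
  also have "cmod \<dots> \<le> (\<Sum>k = 0..<n. (real n * c) ^ m * c)"
  proof (rule sum_norm_le)
    fix k assume "k \<in> {0..<n}"
    then have k: "k < n" by simp
    show "cmod ((A ^\<^sub>m m) $$ (i, k) * A $$ (k, j)) \<le> (real n * c) ^ m * c"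
      unfolding norm_mult
      by (rule mult_mono[OF Suc.IH[OF i k] c[OF k Suc.prems(2)]]) (use c0 in auto)
  qed
  also have "\<dots> = (real n * c) ^ Suc m" by simp
  finally show ?case .
qed

lemma summable_mat_exp:
  fixes A :: "complex mat"
  assumes A: "A \<in> carrier_mat n n" and i: "i < n" and j: "j < n"
  shows "summable (\<lambda>m. (A ^\<^sub>m m) $$ (i, j) / fact m)"
proof -
  define c where "c = (\<Sum>k<n. \<Sum>l<n. cmod (A $$ (k, l)))"
  have c: "cmod (A $$ (k, l)) \<le> c" if "k < n" "l < n" for k l
  proof -
    have "cmod (A $$ (k, l)) \<le> (\<Sum>l<n. cmod (A $$ (k, l)))"
      by (rule member_le_sum) (use that in auto)
    also have "\<dots> \<le> c" unfolding c_def
      by (rule member_le_sum[of k "{..<n}" "\<lambda>k. \<Sum>l<n. cmod (A $$ (k, l))"])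
        (use that in \<open>auto intro: sum_nonneg\<close>)
    finally show ?thesis .
  qed
  have "summable (\<lambda>m. inverse (fact m) * (real n * c) ^ m)" by (rule summable_exp)
  then show ?thesis
  proof (rule summable_comparison_test')
    fix m :: nat
    have "cmod ((A ^\<^sub>m m) $$ (i, j)) * inverse (fact m) \<le> (real n * c) ^ m * inverse (fact m)"
      by (rule mult_right_mono[OF norm_pow_mat_le[OF A i j c]]) auto
    then show "cmod ((A ^\<^sub>m m) $$ (i, j) / fact m) \<le> inverse (fact m) * (real n * c) ^ m"
      by (simp add: norm_divide norm_mult norm_inverse divide_inverse mult.commute)
  qed
qed

end

theory Submission
  imports Defs "HOL-Analysis.Complex_Analysis_Basics" "HOL-Computational_Algebra.Polynomial"
begin

text \<open>
  Write \<open>A = (N + 1) I - J\<close>, where \<open>J\<close> has the entries \<open>\<beta>\<^sub>k\<close> next to the diagonal. The matrix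
  \<open>i J\<close> is the generator, in a normalised monomial basis, of the one-parameter group of substitutions
  \<open>x \<mapsto> x cos t + i sin t\<close>, \<open>1 \<mapsto> cos t + i x sin t\<close> on binary forms of degree \<open>N\<close>: the polynomials
  \<open>P\<^sub>k(t, x) = (x cos t + i sin t)\<^sup>k (cos t + i x sin t)\<^bsup>N - k\<^esup>\<close> satisfy
  \<open>\<partial>\<^sub>t P\<^sub>k = i k P\<^bsub>k - 1\<^esub> + i (N - k) P\<^bsub>k + 1\<^esub>\<close> and \<open>P\<^sub>k(0, x) = x\<^sup>k\<close>. Multiplying the coefficient of
  \<open>x\<^sup>n\<close> in \<open>P\<^sub>k\<close> by the square root of the quotient of the binomial coefficients \<open>N\<close> over \<open>k\<close> and
  \<open>N\<close> over \<open>n\<close> makes this system symmetric, and a factor \<open>exp (- i (N + 1) t)\<close> accounts for the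
  diagonal of \<open>A\<close>. The resulting matrix \<open>W(t)\<close> solves \<open>W' = W (- i A)\<close> with \<open>W(0) = I\<close>
  (\<open>kravchuk_flow_deriv\<close>, \<open>kravchuk_flow_0\<close>), hence \<open>W(t) = exp (- i t A)\<close> (\<open>mat_exp_kravchuk_A\<close>).

  At \<open>t = \<pi> / 4\<close> the polynomial \<open>P\<^sub>k\<close> is \<open>2\<^bsup>- N / 2\<^esup> (x + i)\<^sup>k (1 + i x)\<^bsup>N - k\<^esup>\<close>. Up to the phases
  \<open>i\<^sup>n\<close> and \<open>(- i)\<^sup>k\<close>, which conjugation by \<open>D\<close> supplies, this is the generating function
  \<open>(1 + x)\<^sup>k (1 - x)\<^bsup>N - k\<^esup>\<close> of the Kravchuk polynomials at the \<open>k\<close>-th node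
  (\<open>kravchuk_poly_node\<close>). Comparing normalisations (\<open>kravchuk_phi_eq\<close>) gives the factorisation of
  \<open>L\<close>. The identity \<open>C = L F\<close> only needs that the nodes \<open>a\<^sub>0, \<dots>, a\<^sub>N\<close> enumerate the lattice, which
  is where \<open>N\<close> must be even (\<open>kravchuk_lattice_eq\<close>).
\<close>

section \<open>The matrix exponential as the solution of a linear differential equation\<close>

text \<open>
  A solution \<open>W\<close> of \<open>W' = W B\<close> with \<open>W(0) = I\<close> has \<open>W\<^sup>(\<^sup>m\<^sup>) = W B\<^sup>m\<close>. As \<open>W\<close> is bounded on the unit
  disc and \<open>B\<^sup>m\<close> grows at most geometrically, Taylor expansion of \<open>W\<close> at \<open>0\<close> converges at \<open>1\<close>.
\<close>
lemma mat_exp_eqI: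
  fixes B :: "complex mat" and W :: "complex \<Rightarrow> nat \<Rightarrow> nat \<Rightarrow> complex"
  assumes B: "B \<in> carrier_mat n n"
    and W': "\<And>t i j. i < n \<Longrightarrow> j < n \<Longrightarrow>
      ((\<lambda>t. W t i j) has_field_derivative (\<Sum>l<n. W t i l * B $$ (l, j))) (at t)"
    and W0: "\<And>i j. i < n \<Longrightarrow> j < n \<Longrightarrow> W 0 i j = of_bool (i = j)"
  shows "mat_exp B = Matrix.mat n n (\<lambda>(i, j). W 1 i j)"
proof (rule eq_matI)
  show "dim_row (mat_exp B) = dim_row (Matrix.mat n n (\<lambda>(i, j). W 1 i j))"
    "dim_col (mat_exp B) = dim_col (Matrix.mat n n (\<lambda>(i, j). W 1 i j))"
    using B by (auto simp: mat_exp_def)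
next
  fix i j
  assume "i < dim_row (Matrix.mat n n (\<lambda>(i, j). W 1 i j))"
    and "j < dim_col (Matrix.mat n n (\<lambda>(i, j). W 1 i j))"
  then have i: "i < n" and j: "j < n" by auto
  \<comment> \<open>the \<open>m\<close>-th derivative of the entry \<open>(i, j)\<close> of \<open>W\<close>\<close>
  define f where "f m t = (\<Sum>l<n. W t i l * (B ^\<^sub>m m) $$ (l, j))" for m t
  have BSuc: "(B ^\<^sub>m Suc m) $$ (k, j) = (\<Sum>l<n. B $$ (k, l) * (B ^\<^sub>m m) $$ (l, j))"
    if "k < n" for m k
  proof -
    have "B ^\<^sub>m Suc m = B * B ^\<^sub>m m"
    proof (induction m)
      case 0
      then show ?case using B by simp
    next
      case (Suc m)
      have "B ^\<^sub>m Suc (Suc m) = (B * B ^\<^sub>m m) * B" by (metis Suc.IH pow_mat.simps(2))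
      also have "\<dots> = B * (B ^\<^sub>m m * B)"
        by (rule assoc_mult_mat[OF B _ B]) (use B in simp)
      finally show ?case by simp
    qed
    then show ?thesis
      using B that j by (simp add: scalar_prod_def atLeast0LessThan)
  qed
  have f': "(f m has_field_derivative f (Suc m) t) (at t)" for m t
  proof -
    have "(f m has_field_derivative
        (\<Sum>l<n. (\<Sum>k<n. W t i k * B $$ (k, l)) * (B ^\<^sub>m m) $$ (l, j))) (at t)"
      unfolding f_def by (intro DERIV_sum DERIV_cmult_right W') (use i in auto)
    also have "(\<Sum>l<n. (\<Sum>k<n. W t i k * B $$ (k, l)) * (B ^\<^sub>m m) $$ (l, j)) = f (Suc m) t"
      unfolding f_def
      by (simp add: BSuc sum_distrib_left sum_distrib_right mult.assoc del: pow_mat.simps)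
        (rule sum.swap)
    finally show ?thesis .
  qed
  have "\<exists>b. \<forall>t\<in>cball 0 1. \<forall>l<n. cmod (W t i l) \<le> b"
  proof -
    have "compact ((\<lambda>t. \<Sum>l<n. cmod (W t i l)) ` cball 0 1)"
      by (intro compact_continuous_image continuous_intros compact_cball)
        (auto intro!: continuous_at_imp_continuous_on DERIV_isCont[OF W'[OF i]])
    then have "\<exists>b. \<forall>t\<in>cball 0 1. \<bar>\<Sum>l<n. cmod (W t i l)\<bar> \<le> b"
      by (auto dest!: compact_imp_bounded simp: bounded_iff simp del: mem_cball mem_cball_0)
    then obtain b where b: "\<And>t. t \<in> cball 0 1 \<Longrightarrow> \<bar>\<Sum>l<n. cmod (W t i l)\<bar> \<le> b"
      by blast
    have "cmod (W t i l) \<le> b" if "t \<in> cball 0 1" "l < n" for t l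
    proof -
      have "cmod (W t i l) \<le> (\<Sum>l<n. cmod (W t i l))"
        by (rule member_le_sum) (use that in auto)
      then show ?thesis using b[OF that(1)] by linarith
    qed
    then show ?thesis by blast
  qed
  then obtain b where b: "\<And>t l. t \<in> cball 0 1 \<Longrightarrow> l < n \<Longrightarrow> cmod (W t i l) \<le> b" by blast
  define c where "c = (\<Sum>k<n. \<Sum>l<n. cmod (B $$ (k, l)))"
  have c: "cmod (B $$ (k, l)) \<le> c" if "k < n" "l < n" for k l
  proof -
    have "cmod (B $$ (k, l)) \<le> (\<Sum>l<n. cmod (B $$ (k, l)))"
      by (rule member_le_sum) (use that in auto)
    also have "\<dots> \<le> c" unfolding c_def
      by (rule member_le_sum[of k "{..<n}" "\<lambda>k. \<Sum>l<n. cmod (B $$ (k, l))"])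
        (use that in \<open>auto intro: sum_nonneg\<close>)
    finally show ?thesis .
  qed
  have b0: "0 \<le> b" using b[of 0 i] i by (auto intro: order_trans[OF norm_ge_zero])
  have fbound: "cmod (f m t) \<le> real n * (b * (real n * c) ^ m)" if t: "t \<in> cball 0 1" for m t
  proof -
    have "cmod (f m t) \<le> (\<Sum>l<n. b * (real n * c) ^ m)"
      unfolding f_def
    proof (rule sum_norm_le)
      fix l assume "l \<in> {..<n}"
      then have l: "l < n" by simp
      show "cmod (W t i l * (B ^\<^sub>m m) $$ (l, j)) \<le> b * (real n * c) ^ m"
        unfolding norm_mult
        by (rule mult_mono[OF b[OF t l] norm_pow_mat_le[OF B l j c]]) (use b0 in auto)
    qed
    then show ?thesis by simp
  qed
  have f0: "f m 0 = (B ^\<^sub>m m) $$ (i, j)" for m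
  proof -
    have "f m 0 = (\<Sum>l<n. if l = i then (B ^\<^sub>m m) $$ (l, j) else 0)"
      unfolding f_def by (rule sum.cong) (auto simp: W0 i)
    then show ?thesis using i by (simp add: sum.delta)
  qed
  have Taylor: "cmod (f 0 1 - (\<Sum>k\<le>m. (B ^\<^sub>m k) $$ (i, j) / fact k))
      \<le> real n * b * (real n * c) * (inverse (fact m) * (real n * c) ^ m)" for m
  proof -
    have "cmod (f 0 1 - (\<Sum>k\<le>m. f k 0 * (1 - 0) ^ k / fact k))
      \<le> real n * (b * (real n * c) ^ Suc m) * cmod (1 - 0) ^ Suc m / fact m"
    proof (rule complex_Taylor[where S = "cball 0 1"])
      show "cmod (f (Suc m) t) \<le> real n * (b * (real n * c) ^ Suc m)" if "t \<in> cball 0 1" for t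
        by (rule fbound[OF that])
    qed (auto intro: has_field_derivative_at_within[OF f'])
    then show ?thesis by (simp add: f0 divide_inverse mult_ac)
  qed
  have "(\<lambda>m. real n * b * (real n * c) * (inverse (fact m) * (real n * c) ^ m)) \<longlonglongrightarrow> 0"
    by (intro tendsto_mult_right_zero summable_LIMSEQ_zero summable_exp)
  then have "(\<lambda>m. f 0 1 - (\<Sum>k\<le>m. (B ^\<^sub>m k) $$ (i, j) / fact k)) \<longlonglongrightarrow> 0"
    by (rule Lim_null_comparison[OF always_eventually, rotated]) (use Taylor in blast)
  then have "(\<lambda>m. \<Sum>k\<le>m. (B ^\<^sub>m k) $$ (i, j) / fact k) \<longlonglongrightarrow> f 0 1"
    using tendsto_diff[OF tendsto_const[of "f 0 1"]] by fastforce
  then have "(\<lambda>m. (B ^\<^sub>m m) $$ (i, j) / fact m) sums f 0 1"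
    by (simp add: sums_def_le)
  moreover have "f 0 1 = W 1 i j"
  proof -
    have "f 0 1 = (\<Sum>l<n. if l = j then W 1 i l else 0)"
      unfolding f_def by (rule sum.cong) (use B j in auto)
    then show ?thesis using j by (simp add: sum.delta)
  qed
  ultimately show "mat_exp B $$ (i, j) = Matrix.mat n n (\<lambda>(i, j). W 1 i j) $$ (i, j)"
    using B i j by (simp add: mat_exp_def sums_unique[symmetric])
qed

section \<open>Coefficientwise derivatives of polynomials depending on a parameter\<close>

text \<open>
  The polynomial \<open>p'\<close> is the derivative at \<open>t\<close> of the polynomial \<open>p\<close> with respect to the parameter,
  not with respect to the indeterminate.
\<close>
definition coeff_deriv :: "(complex \<Rightarrow> complex poly) \<Rightarrow> complex poly \<Rightarrow> complex \<Rightarrow> bool" where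
  "coeff_deriv p p' t \<longleftrightarrow> (\<forall>n. ((\<lambda>t. coeff (p t) n) has_field_derivative coeff p' n) (at t))"

lemma coeff_deriv_mult:
  assumes "coeff_deriv p p' t" "coeff_deriv q q' t"
  shows "coeff_deriv (\<lambda>t. p t * q t) (p' * q t + p t * q') t"
  unfolding coeff_deriv_def
proof
  fix n
  have "((\<lambda>t. \<Sum>i\<le>n. coeff (p t) i * coeff (q t) (n - i)) has_field_derivative
     (\<Sum>i\<le>n. coeff (p t) i * coeff q' (n - i) + coeff p' i * coeff (q t) (n - i))) (at t)"
    by (intro DERIV_sum DERIV_mult') (use assms in \<open>auto simp: coeff_deriv_def\<close>)
  then show "((\<lambda>t. coeff (p t * q t) n) has_field_derivative coeff (p' * q t + p t * q') n) (at t)"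
    by (simp add: coeff_mult sum.distrib add.commute)
qed

lemma coeff_deriv_power:
  assumes "coeff_deriv p p' t"
  shows "coeff_deriv (\<lambda>t. p t ^ m) (of_nat m * p' * p t ^ (m - 1)) t"
proof (induction m)
  case 0
  then show ?case by (simp add: coeff_deriv_def)
next
  case (Suc m)
  have "p' * p t ^ m + p t * (of_nat m * p' * p t ^ (m - 1))
      = of_nat (Suc m) * p' * p t ^ (Suc m - 1)"
    by (cases m) (simp_all add: algebra_simps)
  then show ?case
    using coeff_deriv_mult[OF assms Suc.IH] by simp
qed

lemma coeff_deriv_linear:
  assumes "(a has_field_derivative a') (at t)" "(b has_field_derivative b') (at t)"
  shows "coeff_deriv (\<lambda>t. [:a t, b t:]) [:a', b':] t"
  using assms by (auto simp: coeff_deriv_def coeff_pCons split: nat.split)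

section \<open>The flow generated by the tridiagonal matrix\<close>

text \<open>
  The image of the binary form \<open>x\<^sup>k y\<^bsup>N - k\<^esup>\<close> under the substitution \<open>x \<mapsto> x cos t + i y sin t\<close>,
  \<open>y \<mapsto> y cos t + i x sin t\<close>, written inhomogeneously with \<open>y = 1\<close>. It is meant for \<open>k \<le> N\<close>.
\<close>
definition rot_poly :: "nat \<Rightarrow> nat \<Rightarrow> complex \<Rightarrow> complex poly" where
  "rot_poly N k t = [:\<i> * sin t, cos t:] ^ k * [:cos t, \<i> * sin t:] ^ (N - k)"

text \<open>
  The two linear factors are exchanged by differentiation, up to a factor \<open>i\<close>. The index \<open>k - 1\<close> for
  \<open>k = 0\<close> and the index \<open>k + 1\<close> for \<open>k = N\<close> are harmless because their coefficients vanish.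
\<close>
lemma rot_poly_deriv:
  assumes k: "k \<le> N"
  shows "coeff_deriv (rot_poly N k)
    (smult (\<i> * of_nat k) (rot_poly N (k - 1) t) +
     smult (\<i> * of_nat (N - k)) (rot_poly N (k + 1) t)) t"
proof -
  let ?u = "\<lambda>t. [:\<i> * sin t, cos t:]" and ?v = "\<lambda>t. [:cos t, \<i> * sin t:]"
  have u: "coeff_deriv ?u (smult \<i> (?v t)) t"
    using coeff_deriv_linear[of "\<lambda>t. \<i> * sin t" "\<i> * cos t" t cos "- sin t"]
      DERIV_cmult[OF DERIV_sin, of \<i> t]
    by simp
  have v: "coeff_deriv ?v (smult \<i> (?u t)) t"
    using coeff_deriv_linear[of cos "- sin t" t "\<lambda>t. \<i> * sin t" "\<i> * cos t"]
      DERIV_cmult[OF DERIV_sin, of \<i> t]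
    by simp
  have 1: "of_nat k * smult \<i> (?v t) * ?u t ^ (k - 1) * ?v t ^ (N - k)
      = smult (\<i> * of_nat k) (rot_poly N (k - 1) t)"
  proof (cases k)
    case (Suc m)
    then have "N - (k - 1) = Suc (N - k)" using k by simp
    moreover have "of_nat k * smult \<i> q * p ^ (k - 1) * q ^ (N - k)
        = smult (\<i> * of_nat k) (p ^ (k - 1) * q ^ Suc (N - k))" for p q :: "complex poly"
      by (simp add: mult_ac of_nat_poly)
    ultimately show ?thesis by (simp only: rot_poly_def)
  qed simp
  have 2: "?u t ^ k * (of_nat (N - k) * smult \<i> (?u t) * ?v t ^ (N - k - 1))
      = smult (\<i> * of_nat (N - k)) (rot_poly N (k + 1) t)"
  proof -
    have "p ^ k * (of_nat (N - k) * smult \<i> p * q ^ (N - k - 1))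
        = smult (\<i> * of_nat (N - k)) (p ^ (k + 1) * q ^ (N - (k + 1)))" for p q :: "complex poly"
      by (simp add: mult_ac of_nat_poly)
    then show ?thesis by (simp only: rot_poly_def)
  qed
  show ?thesis
    using coeff_deriv_mult[OF coeff_deriv_power[OF u, of k] coeff_deriv_power[OF v, of "N - k"]]
    unfolding 1 2 by (simp add: rot_poly_def[abs_def])
qed

text \<open>
  The square roots of the binomial coefficients are the weights that turn the coefficients \<open>k\<close> and
  \<open>N - k\<close> of the differential equation into the symmetric ones \<open>\<beta>\<^sub>k\<close>.
\<close>
lemma sqrt_binomial_Suc:
  assumes "m < N"
  shows "kravchuk_beta N (Suc m) * sqrt (N choose m) = real (Suc m) * sqrt (N choose Suc m)"
    and "kravchuk_beta N (Suc m) * sqrt (N choose Suc m) = real (N - m) * sqrt (N choose m)"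
proof -
  have "Suc m * (N choose Suc m) = (N - m) * (N choose m)"
    using binomial_absorption[of m N] binomial_absorb_comp[of N m] assms by simp
  then have *: "real (Suc m) * real (N choose Suc m) = real (N - m) * real (N choose m)"
    using of_nat_mult[where 'a = real] by metis
  have \<beta>: "kravchuk_beta N (Suc m) = sqrt (real (Suc m)) * sqrt (real (N - m))"
  proof -
    have "N - Suc m + 1 = N - m" using assms by simp
    then show ?thesis by (simp only: kravchuk_beta_def of_nat_mult real_sqrt_mult)
  qed
  have sq: "sqrt (real (Suc m)) * sqrt (N choose Suc m) = sqrt (real (N - m)) * sqrt (N choose m)"
    using * by (metis real_sqrt_mult)
  have "kravchuk_beta N (Suc m) * sqrt (N choose m) = sqrt (Suc m) * (sqrt (N - m) * sqrt (N choose m))"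
    by (simp only: \<beta> mult.assoc)
  also have "\<dots> = real (Suc m) * sqrt (N choose Suc m)"
    unfolding sq[symmetric] by (simp add: mult.assoc[symmetric] del: of_nat_Suc)
  finally show "kravchuk_beta N (Suc m) * sqrt (N choose m) = real (Suc m) * sqrt (N choose Suc m)" .
  have "kravchuk_beta N (Suc m) * sqrt (N choose Suc m) =
      sqrt (N - m) * (sqrt (Suc m) * sqrt (N choose Suc m))"
    by (simp only: \<beta> mult_ac)
  also have "\<dots> = real (N - m) * sqrt (N choose m)"
    unfolding sq by (simp add: mult.assoc[symmetric])
  finally show "kravchuk_beta N (Suc m) * sqrt (N choose Suc m) = real (N - m) * sqrt (N choose m)" .
qed

lemma sum_kravchuk_A:
  fixes w :: "nat \<Rightarrow> complex"
  assumes j: "j \<le> N"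
  shows "(\<Sum>l<N + 1. w l * complex_of_real (kravchuk_A N $$ (l, j))) =
    of_nat (N + 1) * w j
    - (if j = 0 then 0 else of_real (kravchuk_beta N j) * w (j - 1))
    - (if j = N then 0 else of_real (kravchuk_beta N (j + 1)) * w (j + 1))"
proof -
  have "(\<Sum>l<N + 1. w l * complex_of_real (kravchuk_A N $$ (l, j))) =
    (\<Sum>l<N + 1. (if l = j then of_nat (N + 1) * w j else 0)
      - (if l = j - 1 then if j = 0 then 0 else of_real (kravchuk_beta N j) * w (j - 1) else 0)
      - (if l = j + 1 then of_real (kravchuk_beta N (j + 1)) * w (j + 1) else 0))"
    by (rule sum.cong) (use j in \<open>auto simp: kravchuk_A_def\<close>)
  also have "\<dots> = of_nat (N + 1) * w j
    - (if j = 0 then 0 else of_real (kravchuk_beta N j) * w (j - 1))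
    - (if j = N then 0 else of_real (kravchuk_beta N (j + 1)) * w (j + 1))"
    using j by (auto simp: sum_subtractf sum.delta simp del: sum.lessThan_Suc)
  finally show ?thesis .
qed

text \<open>
  The entries of the matrix \<open>exp (- i t A)\<close>: coefficients of the transformed monomials, normalised
  by the weights and multiplied by the phase that comes from the diagonal of \<open>A\<close>.
\<close>
definition kravchuk_flow :: "nat \<Rightarrow> complex \<Rightarrow> nat \<Rightarrow> nat \<Rightarrow> complex" where
  "kravchuk_flow N t i j = exp (- (\<i> * of_nat (N + 1) * t)) *
     of_real (sqrt (N choose j) / sqrt (N choose i)) * coeff (rot_poly N j t) i"

lemma kravchuk_flow_deriv:
  assumes j: "j \<le> N"
  shows "((\<lambda>t. kravchuk_flow N t i j) has_field_derivative
    (\<Sum>l<N + 1. kravchuk_flow N t i l * (- \<i> * complex_of_real (kravchuk_A N $$ (l, j))))) (at t)"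
proof -
  define e where "e = exp (- (\<i> * of_nat (N + 1) * t))"
  define s where "s l = complex_of_real (sqrt (N choose l))" for l
  define r where "r l = coeff (rot_poly N l t) i" for l
  have flow: "kravchuk_flow N t i l = e * (s l / s i) * r l" for l
    by (simp add: kravchuk_flow_def e_def s_def r_def)
  \<comment> \<open>The weights turn the coefficients of the two neighbours of \<open>j\<close> into \<open>\<beta>\<close>. At \<open>j = 0\<close> and
    \<open>j = N\<close> the missing neighbour has coefficient \<open>0\<close> in the differential equation.\<close>
  have low: "of_real (kravchuk_beta N j) * s (j - 1) = of_nat j * s j" if "j \<noteq> 0"
    using arg_cong[OF sqrt_binomial_Suc(1)[of "j - 1" N], of complex_of_real] that j
    by (simp add: s_def del: of_nat_Suc)
  have high: "of_real (kravchuk_beta N (j + 1)) * s (j + 1) = of_nat (N - j) * s j" if "j \<noteq> N"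
    using arg_cong[OF sqrt_binomial_Suc(2)[of j N], of complex_of_real] that j
    by (simp add: s_def)
  have "((\<lambda>t. kravchuk_flow N t i j) has_field_derivative
      (- \<i> * of_nat (N + 1)) * e * (s j / s i) * r j +
      e * (s j / s i) * (\<i> * of_nat j * r (j - 1) + \<i> * of_nat (N - j) * r (j + 1))) (at t)"
  proof -
    have 1: "((\<lambda>t. exp (- (\<i> * of_nat (N + 1) * t))) has_field_derivative
        - \<i> * of_nat (N + 1) * e) (at t)"
      unfolding e_def by (rule derivative_eq_intros refl | simp)+
    have 2: "((\<lambda>t. coeff (rot_poly N j t) i) has_field_derivative
        \<i> * of_nat j * r (j - 1) + \<i> * of_nat (N - j) * r (j + 1)) (at t)"
      using rot_poly_deriv[OF j, of t] by (simp add: coeff_deriv_def r_def)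
    have 3: "kravchuk_flow N u i j
        = exp (- (\<i> * of_nat (N + 1) * u)) * (s j / s i) * coeff (rot_poly N j u) i" for u
      by (simp add: kravchuk_flow_def s_def)
    show ?thesis
      unfolding 3
      by (rule DERIV_cong[OF DERIV_mult[OF DERIV_cmult_right[OF 1] 2]])
        (simp add: e_def r_def mult_ac)
  qed
  also have "(- \<i> * of_nat (N + 1)) * e * (s j / s i) * r j +
      e * (s j / s i) * (\<i> * of_nat j * r (j - 1) + \<i> * of_nat (N - j) * r (j + 1)) =
    - \<i> * (of_nat (N + 1) * kravchuk_flow N t i j
      - e / s i * (of_nat j * s j) * r (j - 1) - e / s i * (of_nat (N - j) * s j) * r (j + 1))"
    by (simp add: flow algebra_simps divide_inverse)
  also have "e / s i * (of_nat j * s j) * r (j - 1) =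
      (if j = 0 then 0 else of_real (kravchuk_beta N j) * kravchuk_flow N t i (j - 1))"
    using low by (simp add: flow mult_ac divide_inverse)
  also have "e / s i * (of_nat (N - j) * s j) * r (j + 1) =
      (if j = N then 0 else of_real (kravchuk_beta N (j + 1)) * kravchuk_flow N t i (j + 1))"
    using high by (simp add: flow mult_ac divide_inverse)
  also have "- \<i> * (of_nat (N + 1) * kravchuk_flow N t i j
      - (if j = 0 then 0 else of_real (kravchuk_beta N j) * kravchuk_flow N t i (j - 1))
      - (if j = N then 0 else of_real (kravchuk_beta N (j + 1)) * kravchuk_flow N t i (j + 1)))
    = (\<Sum>l<N + 1. kravchuk_flow N t i l * (- \<i> * complex_of_real (kravchuk_A N $$ (l, j))))"
    unfolding sum_kravchuk_A[OF j, symmetric]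
    by (simp add: sum_distrib_left mult_ac del: sum.lessThan_Suc)
  finally show ?thesis .
qed

lemma kravchuk_flow_0:
  assumes "i \<le> N" "j \<le> N"
  shows "kravchuk_flow N 0 i j = of_bool (i = j)"
proof -
  have "rot_poly N j 0 = monom 1 j"
    by (simp add: rot_poly_def monom_altdef one_pCons[symmetric])
  moreover have "sqrt (N choose j) \<noteq> 0" using assms by simp
  ultimately show ?thesis by (auto simp: kravchuk_flow_def)
qed

lemma mat_exp_kravchuk_A:
  "mat_exp ((- (\<i> * \<tau>)) \<cdot>\<^sub>m map_mat complex_of_real (kravchuk_A N))
     = Matrix.mat (N + 1) (N + 1) (\<lambda>(i, j). kravchuk_flow N \<tau> i j)"
proof -
  let ?B = "(- (\<i> * \<tau>)) \<cdot>\<^sub>m map_mat complex_of_real (kravchuk_A N)"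
  have "mat_exp ?B = Matrix.mat (N + 1) (N + 1) (\<lambda>(i, j). kravchuk_flow N (1 * \<tau>) i j)"
  proof (rule mat_exp_eqI)
    show "?B \<in> carrier_mat (N + 1) (N + 1)" by (simp add: kravchuk_A_def)
  next
    fix t i j assume "i < N + 1" "j < N + 1"
    then have j: "j \<le> N" by simp
    have "((\<lambda>t. kravchuk_flow N (t * \<tau>) i j) has_field_derivative
        (\<Sum>l<N + 1. kravchuk_flow N (t * \<tau>) i l *
          (- \<i> * complex_of_real (kravchuk_A N $$ (l, j)))) * \<tau>)
        (at t)"
      by (rule DERIV_chain2[OF kravchuk_flow_deriv[OF j]]) (auto intro!: derivative_eq_intros)
    also have "(\<Sum>l<N + 1. kravchuk_flow N (t * \<tau>) i l *
          (- \<i> * complex_of_real (kravchuk_A N $$ (l, j)))) * \<tau>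
        = (\<Sum>l<N + 1. kravchuk_flow N (t * \<tau>) i l * ?B $$ (l, j))"
      unfolding sum_distrib_right
      by (rule sum.cong) (use j in \<open>auto simp: kravchuk_A_def\<close>)
    finally show "((\<lambda>t. kravchuk_flow N (t * \<tau>) i j) has_field_derivative
        (\<Sum>l<N + 1. kravchuk_flow N (t * \<tau>) i l * ?B $$ (l, j))) (at t)" .
  next
    fix i j assume "i < N + 1" "j < N + 1"
    then show "kravchuk_flow N (0 * \<tau>) i j = of_bool (i = j)"
      by (simp add: kravchuk_flow_0)
  qed
  then show ?thesis by simp
qed

section \<open>The generating polynomial of the Kravchuk polynomials\<close>

text \<open>
  The polynomial \<open>(x + i)\<^sup>k (1 + i x)\<^bsup>N - k\<^esup>\<close>. Substituting \<open>i x\<close> for \<open>x\<close> and multiplying by \<open>(- i)\<^sup>k\<close>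
  turns it into the classical generating function \<open>(1 + x)\<^sup>k (1 - x)\<^bsup>N - k\<^esup>\<close>.
\<close>
definition kravchuk_gen :: "nat \<Rightarrow> nat \<Rightarrow> complex poly" where
  "kravchuk_gen N k = [:\<i>, 1:] ^ k * [:1, \<i>:] ^ (N - k)"

lemma rot_poly_quarter:
  assumes "k \<le> N"
  shows "rot_poly N k (of_real pi / 4) = smult ((1 / of_real (sqrt 2)) ^ N) (kravchuk_gen N k)"
proof -
  have half: "sqrt 2 / 2 = 1 / sqrt 2" by (simp add: field_simps)
  have c: "cos (complex_of_real pi / 4) = 1 / of_real (sqrt 2)"
    using cos_of_real[of "pi / 4", where 'a = complex] unfolding cos_45 half by simp
  have s: "sin (complex_of_real pi / 4) = 1 / of_real (sqrt 2)"
    using sin_of_real[of "pi / 4", where 'a = complex] unfolding sin_45 half by simp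
  have u: "[:\<i> * sin (complex_of_real pi / 4), cos (complex_of_real pi / 4):]
      = smult (1 / of_real (sqrt 2)) [:\<i>, 1:]"
    "[:cos (complex_of_real pi / 4), \<i> * sin (complex_of_real pi / 4):]
      = smult (1 / of_real (sqrt 2)) [:1, \<i>:]"
    by (simp_all add: c s)
  have "smult a p ^ k * smult a q ^ (N - k) = smult (a ^ N) (p ^ k * q ^ (N - k))"
    for a and p q :: "complex poly"
  proof -
    have "a ^ N = a ^ (N - k) * a ^ k" using assms by (simp flip: power_add)
    then show ?thesis
      by (simp only: smult_power mult_smult_left mult_smult_right smult_smult mult.commute)
  qed
  then show ?thesis
    unfolding rot_poly_def kravchuk_gen_def u .
qed

text \<open>
  The logarithmic derivative, cleared of its denominator \<open>(x + i) (1 + i x) = i + i x\<^sup>2\<close>. Comparing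
  coefficients in it gives the three-term recurrence.
\<close>
lemma kravchuk_gen_ode:
  assumes "k \<le> N"
  shows "[:\<i>, 0, \<i>:] * pderiv (kravchuk_gen N k) =
    smult (of_nat k) ([:1, \<i>:] * kravchuk_gen N k)
    + smult (\<i> * of_nat (N - k)) ([:\<i>, 1:] * kravchuk_gen N k)"
proof -
  let ?u = "[:\<i>, 1:]" and ?v = "[:1, \<i>:]"
  have pw: "p * pderiv (p ^ m) = smult (of_nat m) (pderiv p * p ^ m)" for p :: "complex poly" and m
  proof (cases m)
    case (Suc l)
    show ?thesis
      unfolding Suc pderiv_power_Suc by (simp only: power_Suc mult_smult_left mult_smult_right mult_ac)
  qed simp
  have "[:\<i>, 0, \<i>:] * pderiv (kravchuk_gen N k)
     = ?v * (?u * pderiv (?u ^ k)) * ?v ^ (N - k) + ?u * ?u ^ k * (?v * pderiv (?v ^ (N - k)))"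
  proof -
    have "[:\<i>, 0, \<i>:] = ?u * ?v" by simp
    then show ?thesis unfolding kravchuk_gen_def pderiv_mult by (simp only: algebra_simps)
  qed
  also have "\<dots> = smult (of_nat k) (?v * kravchuk_gen N k)
      + smult (\<i> * of_nat (N - k)) (?u * kravchuk_gen N k)"
  proof -
    have u: "pderiv ?u = 1" and v: "pderiv ?v = smult \<i> 1" by (simp_all add: pderiv_pCons)
    show ?thesis
      unfolding pw u v kravchuk_gen_def
      by (simp only: mult_smult_left mult_smult_right smult_smult mult_1_left mult_1_right mult_ac)
  qed
  finally show ?thesis .
qed

lemma kravchuk_gen_coeff_rec:
  assumes "k \<le> N"
  shows "coeff (kravchuk_gen N k) 0 = \<i> ^ k"
    and "\<i> * coeff (kravchuk_gen N k) 1 = (2 * of_nat k - of_nat N) * coeff (kravchuk_gen N k) 0"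
    and "\<i> * of_nat (n + 2) * coeff (kravchuk_gen N k) (n + 2) =
      (2 * of_nat k - of_nat N) * coeff (kravchuk_gen N k) (n + 1)
      + \<i> * (of_nat N - of_nat n) * coeff (kravchuk_gen N k) n"
proof -
  define r where "r = kravchuk_gen N k"
  note ode = kravchuk_gen_ode[OF assms, folded r_def]
  show "coeff (kravchuk_gen N k) 0 = \<i> ^ k"
    by (simp add: kravchuk_gen_def coeff_mult_0 coeff_0_power)
  show "\<i> * coeff (kravchuk_gen N k) 1 = (2 * of_nat k - of_nat N) * coeff (kravchuk_gen N k) 0"
    using arg_cong[OF ode, of "\<lambda>p. coeff p 0"] assms
    unfolding r_def[symmetric] by (simp add: coeff_pderiv of_nat_diff algebra_simps)
  have m: "coeff (pCons 0 (smult \<i> (pderiv r))) n = \<i> * (of_nat n * coeff r n)"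
    by (cases n) (simp_all add: coeff_pderiv)
  have "\<i> * (of_nat (n + 2) * coeff r (n + 2)) + \<i> * (of_nat n * coeff r n) =
      of_nat k * (coeff r (n + 1) + \<i> * coeff r n)
      + \<i> * of_nat (N - k) * (\<i> * coeff r (n + 1) + coeff r n)"
    using arg_cong[OF ode, of "\<lambda>p. coeff p (Suc n)"] m
    by (simp add: coeff_pderiv coeff_pCons_Suc algebra_simps)
  then show "\<i> * of_nat (n + 2) * coeff (kravchuk_gen N k) (n + 2) =
      (2 * of_nat k - of_nat N) * coeff (kravchuk_gen N k) (n + 1)
      + \<i> * (of_nat N - of_nat n) * coeff (kravchuk_gen N k) n"
    using assms unfolding r_def[symmetric] by (simp add: of_nat_diff algebra_simps)
qed

text \<open>
  Both sides satisfy the same three-term recurrence in \<open>n\<close>, since \<open>2 a\<^sub>k = h (2 k - N)\<close> and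
  \<open>2 - h\<^sup>2 n = h\<^sup>2 (N - n)\<close> when \<open>N h\<^sup>2 = 2\<close>.
\<close>
lemma kravchuk_poly_node:
  assumes k: "k \<le> N" and h: "h \<noteq> 0" and Nh: "real N * h\<^sup>2 = 2"
  shows "complex_of_real (kravchuk_poly h n (kravchuk_node h k)) =
    of_real (h ^ n * fact n) * (\<i> ^ n * (- \<i>) ^ k * coeff (kravchuk_gen N k) n)"
proof -
  define r where "r = coeff (kravchuk_gen N k)"
  define x where "x = kravchuk_node h k"
  note rec = kravchuk_gen_coeff_rec[OF k, folded r_def]
  have "2 * x * h = h\<^sup>2 * (2 * real k - real N)"
    using h Nh by (simp add: x_def kravchuk_node_def field_simps power2_eq_square)
  then have x: "2 * x = h * (2 * real k - real N)"
    using h by (simp add: power2_eq_square)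
  have cx: "2 * complex_of_real x = of_real h * (2 * of_nat k - of_nat N)"
    using arg_cong[OF x, of complex_of_real] by simp
  have kk: "(- \<i>) ^ k * \<i> ^ k = 1"
    by (simp add: power_mult_distrib[symmetric])
  have "complex_of_real (kravchuk_poly h n x) =
      of_real (h ^ n * fact n) * (\<i> ^ n * (- \<i>) ^ k * r n)"
  proof (induction n rule: induct_nat_012)
    case 0
    then show ?case by (simp add: rec(1) kk)
  next
    case 1
    have "complex_of_real (kravchuk_poly h (Suc 0) x) =
        of_real h * (2 * of_nat k - of_nat N) * ((- \<i>) ^ k * r 0)"
      by (simp add: cx rec(1) kk)
    also have "\<dots> = of_real h * (- \<i>) ^ k * (\<i> * r 1)"
      using rec(2) by simp
    finally show ?case by simp
  next
    case (ge2 n)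
    have "2 * (1 - h\<^sup>2 * (real n / 2)) = real N * h\<^sup>2 - h\<^sup>2 * real n" using Nh by simp
    also have "\<dots> = h\<^sup>2 * (real N - real n)" by (simp add: algebra_simps)
    finally have step: "2 * (1 - h\<^sup>2 * (real n / 2)) = h\<^sup>2 * (real N - real n)" .
    have "2 * real (Suc n) * (1 - h\<^sup>2 * (real n / 2)) * kravchuk_poly h n x
        = real (Suc n) * (h\<^sup>2 * (real N - real n)) * kravchuk_poly h n x"
      unfolding step[symmetric] by (simp only: mult_ac)
    then have step': "kravchuk_poly h (Suc (Suc n)) x = 2 * x * kravchuk_poly h (Suc n) x
        - real (Suc n) * (h\<^sup>2 * (real N - real n)) * kravchuk_poly h n x"
      by (simp only: kravchuk_poly.simps)
    have "complex_of_real (kravchuk_poly h (Suc (Suc n)) x) =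
        2 * of_real x * of_real (kravchuk_poly h (Suc n) x)
        - of_nat (Suc n) * (of_real h ^ 2 * (of_nat N - of_nat n)) * of_real (kravchuk_poly h n x)"
      unfolding step' by simp
    also have "\<dots> = of_real (h ^ Suc (Suc n) * fact (Suc n)) * (\<i> ^ Suc n * (- \<i>) ^ k) *
        ((2 * of_nat k - of_nat N) * r (n + 1) + \<i> * (of_nat N - of_nat n) * r n)"
      unfolding ge2 cx by (simp add: algebra_simps power2_eq_square)
    also have "\<dots> = of_real (h ^ Suc (Suc n) * fact (Suc n)) * (\<i> ^ Suc n * (- \<i>) ^ k) *
        (\<i> * of_nat (n + 2) * r (n + 2))"
      unfolding rec(3) ..
    also have "\<dots> = of_real (h ^ Suc (Suc n) * fact (Suc (Suc n))) *
        (\<i> ^ Suc (Suc n) * (- \<i>) ^ k * r (Suc (Suc n)))"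
      by (simp add: mult_ac)
    finally show ?case .
  qed
  then show ?thesis by (simp add: r_def x_def)
qed


section \<open>Kravchuk functions on the lattice\<close>

text \<open>
  For even \<open>N\<close> the end point \<open>1 / h = h N / 2\<close> of the interval is itself an integer multiple of \<open>h\<close>, so
  that the nodes are lattice points.
\<close>
lemma kravchuk_lattice_eq:
  assumes N: "even N" and h: "h > 0" and Nh: "real N * h\<^sup>2 = 2"
  shows "kravchuk_lattice h = kravchuk_node h ` {0..N}"
proof -
  obtain M where M: "N = 2 * M" using N by (rule evenE)
  have inv: "1 / h = h * real M"
    using Nh h M by (simp add: field_simps power2_eq_square)
  have node: "kravchuk_node h k = h * of_int (int k - int M)" for k
    using inv by (simp add: kravchuk_node_def algebra_simps)
  have mem: "h * of_int m \<in> {- 1 / h..1 / h} \<longleftrightarrow> - int M \<le> m \<and> m \<le> int M" for m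
  proof -
    have "h * of_int m \<in> {- 1 / h..1 / h} \<longleftrightarrow>
        h * (- real M) \<le> h * of_int m \<and> h * of_int m \<le> h * real M"
      using inv by simp
    also have "\<dots> \<longleftrightarrow> - real M \<le> of_int m \<and> of_int m \<le> real M"
      unfolding mult_le_cancel_left_pos[OF h] ..
    also have "\<dots> \<longleftrightarrow> - int M \<le> m \<and> m \<le> int M" by linarith
    finally show ?thesis .
  qed
  show ?thesis
  proof (intro equalityI subsetI)
    fix a assume "a \<in> kravchuk_lattice h"
    then obtain m where a: "a = h * of_int m" and m: "- int M \<le> m" "m \<le> int M"
      using mem unfolding kravchuk_lattice_def by blast
    have "a = kravchuk_node h (nat (m + int M))" using m by (simp add: a node)
    moreover have "nat (m + int M) \<in> {0..N}" using m M by auto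
    ultimately show "a \<in> kravchuk_node h ` {0..N}" by blast
  next
    fix a assume "a \<in> kravchuk_node h ` {0..N}"
    then obtain k where k: "k \<le> N" and a: "a = h * of_int (int k - int M)"
      using node by auto
    have "- int M \<le> int k - int M \<and> int k - int M \<le> int M" using k M by auto
    then have "a \<in> {- 1 / h..1 / h}" unfolding a mem .
    then show "a \<in> kravchuk_lattice h" unfolding kravchuk_lattice_def using a by blast
  qed
qed

lemma kravchuk_rho_node:
  assumes N: "even N" and h: "h > 0" and Nh: "real N * h\<^sup>2 = 2" and k: "k \<le> N"
  shows "kravchuk_rho N h (kravchuk_node h k) = real (N choose k) / (h * 2 ^ N)"
proof -
  have "1 / h\<^sup>2 + kravchuk_node h k / h = real k"
    using h by (simp add: kravchuk_node_def field_simps power2_eq_square)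
  then show ?thesis
    using kravchuk_lattice_eq[OF N h Nh] k by (simp add: kravchuk_rho_def)
qed

lemma kravchuk_coeff_eq:
  assumes N: "even N" and h: "h > 0" and Nh: "real N * h\<^sup>2 = 2"
  shows "kravchuk_coeff N h n f = (\<Sum>k = 0..N. complex_of_real (kravchuk_phi N h n k) *
    (complex_of_real (sqrt h) * f (kravchuk_node h k)))"
proof -
  have inj: "inj_on (kravchuk_node h) {0..N}"
    using h by (auto simp: inj_on_def kravchuk_node_def)
  have sq: "complex_of_real (sqrt h) * complex_of_real (sqrt h) = of_real h"
    using h by (simp flip: of_real_mult)
  show ?thesis
    unfolding kravchuk_coeff_def kravchuk_lattice_eq[OF assms] sum.reindex[OF inj]
      kravchuk_phi_def sum_distrib_left
    by (simp add: sq[symmetric] mult_ac)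
qed

lemma kravchuk_phi_eq:
  assumes N: "even N" and h: "h > 0" and Nh: "real N * h\<^sup>2 = 2" and n: "n \<le> N" and k: "k \<le> N"
  shows "complex_of_real (kravchuk_phi N h n k) =
    (1 / of_real (sqrt 2)) ^ N * of_real (sqrt (N choose k) / sqrt (N choose n)) *
    (\<i> ^ n * (- \<i>) ^ k * coeff (kravchuk_gen N k) n)"
proof -
  have "kravchuk_alpha N h n * (h ^ n * fact n) = 1 / sqrt (N choose n)"
  proof -
    have "kravchuk_alpha N h n * (h ^ n * fact n) =
        sqrt (fact (N - n) / (fact N * fact n)) * sqrt ((fact n)\<^sup>2)"
      using h by (simp add: kravchuk_alpha_def)
    also have "\<dots> = sqrt (1 / real (N choose n))"
      unfolding real_sqrt_mult[symmetric] binomial_fact[OF n]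
      by (simp add: power2_eq_square field_simps)
    finally show ?thesis by (simp add: real_sqrt_divide)
  qed
  then have \<alpha>: "complex_of_real (kravchuk_alpha N h n) * of_real (h ^ n * fact n) =
      of_real (1 / sqrt (N choose n))"
    by (metis of_real_mult)
  have \<rho>: "sqrt h * sqrt (kravchuk_rho N h (kravchuk_node h k)) = (1 / sqrt 2) ^ N * sqrt (N choose k)"
  proof -
    have "h * kravchuk_rho N h (kravchuk_node h k) = real (N choose k) / 2 ^ N"
      using h by (simp add: kravchuk_rho_node[OF N h Nh k])
    then show ?thesis
      by (simp add: real_sqrt_mult[symmetric] real_sqrt_divide real_sqrt_power power_divide)
  qed
  have "kravchuk_phi N h n k = kravchuk_alpha N h n * kravchuk_poly h n (kravchuk_node h k) *
      (sqrt h * sqrt (kravchuk_rho N h (kravchuk_node h k)))"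
    by (simp add: kravchuk_phi_def kravchuk_fun_def)
  then have "complex_of_real (kravchuk_phi N h n k) =
      of_real (kravchuk_alpha N h n) * of_real (kravchuk_poly h n (kravchuk_node h k)) *
      of_real ((1 / sqrt 2) ^ N * sqrt (N choose k))"
    unfolding \<rho> by simp
  also have "\<dots> = (of_real (kravchuk_alpha N h n) * of_real (h ^ n * fact n)) *
      (\<i> ^ n * (- \<i>) ^ k * coeff (kravchuk_gen N k) n) * of_real ((1 / sqrt 2) ^ N * sqrt (N choose k))"
    using kravchuk_poly_node[OF k _ Nh, of n] h by (simp only: mult.assoc)
  also have "\<dots> = (1 / of_real (sqrt 2)) ^ N * of_real (sqrt (N choose k) / sqrt (N choose n)) *
    (\<i> ^ n * (- \<i>) ^ k * coeff (kravchuk_gen N k) n)"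
    unfolding \<alpha> by (simp add: mult_ac)
  finally show ?thesis .
qed

section \<open>The factorisation of the transform matrix\<close>

lemma exp_quarter_turns: "exp (\<i> * of_real pi * of_nat k / 2) = \<i> ^ k"
proof -
  have "exp (\<i> * of_real pi * of_nat k / 2) = exp (of_nat k * (\<i> * of_real (pi / 2)))"
    by (simp add: mult_ac)
  also have "\<dots> = exp (\<i> * of_real (pi / 2)) ^ k" by (rule exp_of_nat_mult)
  also have "exp (\<i> * of_real (pi / 2)) = \<i>"
    by (simp only: cis_conv_exp[symmetric] cis_pi_half)
  finally show ?thesis .
qed

lemma mat_adjoint_mat_diag:
  "mat_adjoint (mat_diag n f) = mat_diag n (\<lambda>k. cnj (f k))"
  by (rule eq_matI) (auto simp: mat_adjoint_def mat_diag_def mat_of_rows_index)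

lemma kravchuk_L_eq:
  assumes N: "even N" and h: "h > 0" and Nh: "real N * h\<^sup>2 = 2"
  shows "kravchuk_L N h =
    exp (\<i> * of_real pi * of_nat (N + 1) / 4) \<cdot>\<^sub>m
      (kravchuk_D N
       * mat_exp ((- (\<i> * of_real pi / 4)) \<cdot>\<^sub>m map_mat complex_of_real (kravchuk_A N))
       * mat_adjoint (kravchuk_D N))"
proof -
  define e where "e = exp (\<i> * of_real pi * of_nat (N + 1) / 4)"
  define W where "W = Matrix.mat (N + 1) (N + 1) (\<lambda>(i, j). kravchuk_flow N (of_real pi / 4) i j)"
  have "kravchuk_D N * W = Matrix.mat (N + 1) (N + 1)
      (\<lambda>(n, k). \<i> ^ n * kravchuk_flow N (of_real pi / 4) n k)"
    unfolding kravchuk_D_def by (subst mat_diag_mult_left[of _ _ "N + 1"])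
      (auto simp: W_def exp_quarter_turns)
  then have prod: "kravchuk_D N * W * mat_adjoint (kravchuk_D N) = Matrix.mat (N + 1) (N + 1)
      (\<lambda>(n, k). \<i> ^ n * kravchuk_flow N (of_real pi / 4) n k * (- \<i>) ^ k)"
    unfolding kravchuk_D_def mat_adjoint_mat_diag
    by (subst mat_diag_mult_right[of _ "N + 1"]) (auto simp: exp_quarter_turns)
  have entry: "complex_of_real (kravchuk_phi N h n k) =
      e * (\<i> ^ n * kravchuk_flow N (of_real pi / 4) n k * (- \<i>) ^ k)"
    if n: "n \<le> N" and k: "k \<le> N" for n k
  proof -
    have "e * exp (- (\<i> * of_nat (N + 1) * (of_real pi / 4))) = exp 0"
      unfolding e_def exp_add[symmetric] by (rule arg_cong[of _ _ exp]) (simp add: field_simps)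
    then have e: "e * (exp (- (\<i> * of_nat (N + 1) * (of_real pi / 4))) * z) = z" for z
      by (simp only: mult.assoc[symmetric] exp_zero mult_1_left)
    have "e * (\<i> ^ n * kravchuk_flow N (of_real pi / 4) n k * (- \<i>) ^ k) =
      e * (exp (- (\<i> * of_nat (N + 1) * (of_real pi / 4))) * (\<i> ^ n * (- \<i>) ^ k *
        (of_real (sqrt (N choose k) / sqrt (N choose n)) * coeff (rot_poly N k (of_real pi / 4)) n)))"
      unfolding kravchuk_flow_def by (simp only: mult_ac)
    also have "\<dots> = complex_of_real (kravchuk_phi N h n k)"
      unfolding e kravchuk_phi_eq[OF N h Nh n k] rot_poly_quarter[OF k] coeff_smult
      by (simp only: mult_ac)
    finally show ?thesis ..
  qed
  have "kravchuk_L N h = e \<cdot>\<^sub>m (kravchuk_D N * W * mat_adjoint (kravchuk_D N))"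
    unfolding prod kravchuk_L_def by (rule eq_matI) (auto simp: entry)
  moreover have "mat_exp ((- (\<i> * of_real pi / 4)) \<cdot>\<^sub>m map_mat complex_of_real (kravchuk_A N)) = W"
    using mat_exp_kravchuk_A[of "of_real pi / 4" N] by (simp add: W_def)
  ultimately show ?thesis by (simp add: e_def)
qed

theorem theorem3:
  fixes N :: nat and h :: real
  assumes "N \<ge> 1" and "even N"
    and "h = sqrt 2 * real N powr (- 1 / 2)"
  shows "(\<forall>f :: real \<Rightarrow> complex.
            (let F = (\<lambda>k. complex_of_real (sqrt h) * f (kravchuk_node h k)) in
              (\<forall>n\<le>N. kravchuk_coeff N h n f =
                 (\<Sum>k = 0..N. complex_of_real (kravchuk_phi N h n k) * F k)) \<and>
              Matrix.vec (N + 1) (\<lambda>n. kravchuk_coeff N h n f) =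
                kravchuk_L N h *\<^sub>v Matrix.vec (N + 1) F)) \<and>
         kravchuk_L N h =
           exp (\<i> * of_real pi * of_nat (N + 1) / 4) \<cdot>\<^sub>m
             (kravchuk_D N
              * mat_exp ((- (\<i> * of_real pi / 4)) \<cdot>\<^sub>m map_mat complex_of_real (kravchuk_A N))
              * mat_adjoint (kravchuk_D N))"
proof -
  have h: "h > 0" unfolding assms(3) using assms(1) by (intro mult_pos_pos) auto
  have "(real N powr (- 1 / 2))\<^sup>2 = real N powr (- 1 / 2 + - 1 / 2)"
    unfolding power2_eq_square powr_add ..
  also have "\<dots> = inverse (real N)" using assms(1) by (simp add: powr_minus)
  finally have powr: "(real N powr (- 1 / 2))\<^sup>2 = inverse (real N)" .
  have Nh: "real N * h\<^sup>2 = 2"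
    unfolding assms(3) power_mult_distrib powr using assms(1) by simp
  have coeff: "kravchuk_coeff N h n f = (\<Sum>k = 0..N. complex_of_real (kravchuk_phi N h n k) *
      (complex_of_real (sqrt h) * f (kravchuk_node h k)))" for n f
    by (rule kravchuk_coeff_eq[OF assms(2) h Nh])
  have "Matrix.vec (N + 1) (\<lambda>n. kravchuk_coeff N h n f) = kravchuk_L N h *\<^sub>v
      Matrix.vec (N + 1) (\<lambda>k. complex_of_real (sqrt h) * f (kravchuk_node h k))" for f
    by (rule eq_vecI)
      (auto simp: coeff kravchuk_L_def scalar_prod_def atLeastLessThanSuc_atLeastAtMost
        simp del: sum.atLeast0_atMost_Suc sum.op_ivl_Suc)
  then show ?thesis
    using coeff kravchuk_L_eq[OF assms(2) h Nh] unfolding Let_def by blast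
qed

end
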